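(* Let $M_x,M_y\ge 0$ and $r\ge1$ be integers, let $(x_j,y_j)\in[0,1]\times[0,1]$, $j=1,\dots,r$, be pairwise distinct points and let $w_1,\dots,w_r>0$. Let $V=[\,V^{(0)}\ V^{(1)}\ \cdots\ V^{(M_y)}\,]$ be the $r\times (M_x+1)(M_y+1)$ block matrix whose blocks $V^{(l)}$, $l=0,\dots,M_y$, are the $r\times(M_x+1)$ matrices with entries $$V^{(l)}_{j,k}=\varepsilon_{k,l}\sqrt{w_j}\,\cos(\pi kx_j)\cos(\pi l y_j),\qquad j=1,\dots,r,\ k=0,\dots,M_x,$$ where $\varepsilon_{0,0}=\frac1{\sqrt2}$ and $\varepsilon_{k,l}=1$ if $\max\{k,l\}>0$. Then $A:=V^TV$ is a scaled block Toeplitz+Hankel matrix of the form $$A=D(T+H)D,$$ where $D=\operatorname{diag}(\tfrac1{\sqrt2},1,\dots,1)$ is of size $(M_x+1)(M_y+1)\times(M_x+1)(M_y+1)$, and $T$ and $H$ are $(M_y+1)\times(M_y+1)$ block matrices whose $(l,l')$-th blocks ($l,l'=0,\dots,M_y$) are $$T_{(l,l')}=A^{(|l-l'|)},\qquad H_{(l,l')}=A^{(l+l')},$$ for certain $(M_x+1)\times(M_x+1)$ matrices $A^{(0)},\dots,A^{(2M_y)}$, each of which is of the form $A^{(q)}=T^{(q)}+H^{(q)}$, where for real numbers $a^{(q)}_0,\dots,a^{(q)}_{2M_x}$ $$T^{(q)}_{k,k'}=a^{(q)}_{|k-k'|},\qquad H^{(q)}_{k,k'}=a^{(q)}_{k+k'},\qquad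 k,k'=0,\dots,M_x.$$
   Context: All indices for the block rows and block columns, and for rows and columns within blocks, start at $0$. The columns of $V$ are ordered by blocks $l=0,\dots,M_y$ and within each block by $k=0,\dots,M_x$. *)

theory Defs
  imports Complex_Main "Jordan_Normal_Form.Matrix"
begin

text \<open>
  The \<open>p \<times> q\<close> block matrix with \<open>m \<times> n\<close> blocks \<open>B l l'\<close>; the global row
  index \<open>l * m + k\<close> stands for row \<open>k\<close> of block row \<open>l\<close>, and likewise the global column
  index \<open>l' * n + k'\<close> for column \<open>k'\<close> of block column \<open>l'\<close>.
\<close>
definition block_mat :: "nat \<Rightarrow> nat \<Rightarrow> nat \<Rightarrow> nat \<Rightarrow> (nat \<Rightarrow> nat \<Rightarrow> 'a mat) \<Rightarrow> 'a mat" where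
  "block_mat p q m n B =
     mat (p * m) (q * n) (\<lambda>(i, j). B (i div m) (j div n) $$ (i mod m, j mod n))"

definition eps :: "nat \<Rightarrow> nat \<Rightarrow> real" where
  "eps k l = (if k = 0 \<and> l = 0 then 1 / sqrt 2 else 1)"

text \<open>
  The points and weights are indexed by \<open>j = 1, \<dots>, r\<close>, whereas matrix rows are
  numbered from \<open>0\<close>, so row \<open>i\<close> belongs to \<open>j = i + 1\<close>.
\<close>
definition V_block ::
  "nat \<Rightarrow> nat \<Rightarrow> (nat \<Rightarrow> real) \<Rightarrow> (nat \<Rightarrow> real) \<Rightarrow> (nat \<Rightarrow> real) \<Rightarrow> nat \<Rightarrow> real mat" where
  "V_block Mx r w x y l =
     mat r (Mx + 1) (\<lambda>(i, k). let j = i + 1 in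
       eps k l * sqrt (w j) * cos (pi * real k * x j) * cos (pi * real l * y j))"

definition V_mat ::
  "nat \<Rightarrow> nat \<Rightarrow> nat \<Rightarrow> (nat \<Rightarrow> real) \<Rightarrow> (nat \<Rightarrow> real) \<Rightarrow> (nat \<Rightarrow> real) \<Rightarrow> real mat" where
  "V_mat Mx My r w x y = block_mat 1 (My + 1) r (Mx + 1) (\<lambda>_ l. V_block Mx r w x y l)"

definition abs_diff :: "nat \<Rightarrow> nat \<Rightarrow> nat" where
  "abs_diff k k' = nat \<bar>int k - int k'\<bar>"

definition toeplitz_mat :: "nat \<Rightarrow> (nat \<Rightarrow> 'a) \<Rightarrow> 'a mat" where
  "toeplitz_mat n a = mat n n (\<lambda>(k, k'). a (abs_diff k k'))"

definition hankel_mat :: "nat \<Rightarrow> (nat \<Rightarrow> 'a) \<Rightarrow> 'a mat" where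
  "hankel_mat n a = mat n n (\<lambda>(k, k'). a (k + k'))"

definition block_toeplitz_mat :: "nat \<Rightarrow> nat \<Rightarrow> (nat \<Rightarrow> 'a mat) \<Rightarrow> 'a mat" where
  "block_toeplitz_mat p n B = block_mat p p n n (\<lambda>l l'. B (abs_diff l l'))"

definition block_hankel_mat :: "nat \<Rightarrow> nat \<Rightarrow> (nat \<Rightarrow> 'a mat) \<Rightarrow> 'a mat" where
  "block_hankel_mat p n B = block_mat p p n n (\<lambda>l l'. B (l + l'))"

definition D_mat :: "nat \<Rightarrow> real mat" where
  "D_mat n = mat_diag n (\<lambda>i. if i = 0 then 1 / sqrt 2 else 1)"

end

theory Submission imports Defs begin

text \<open>
  Both \<open>T\<close> and \<open>H\<close> come from the identity
  \<open>cos \<alpha> * cos \<beta> = (cos (\<alpha> - \<beta>) + cos (\<alpha> + \<beta>)) / 2\<close>, applied once in the \<open>y\<close> direction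
  (which splits the blocks) and once in the \<open>x\<close> direction (which splits the entries of a block).
  Hence one may take \<open>a\<close> to be a quarter of the cosine moments of the discrete measure with
  weights \<open>w\<close> at the points \<open>(x, y)\<close>. The factor \<open>\<epsilon>\<close> differs from \<open>1\<close> only in
  column \<open>0\<close>, and is therefore absorbed by \<open>D\<close>.
\<close>

text \<open>The frequency \<open>q\<close> in the \<open>y\<close> direction comes first, so that
  fixing it leaves a sequence in \<open>p\<close>, from which a single block is built.\<close>

definition cos_moment ::
  "nat \<Rightarrow> (nat \<Rightarrow> real) \<Rightarrow> (nat \<Rightarrow> real) \<Rightarrow> (nat \<Rightarrow> real) \<Rightarrow> nat \<Rightarrow> nat \<Rightarrow> real" where
  "cos_moment r w x y q p =
     (\<Sum>i<r. w (Suc i) * cos (pi * real p * x (Suc i)) * cos (pi * real q * y (Suc i)))"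

text \<open>Cosine is even, so the absolute value in the Toeplitz index is invisible to it.\<close>

lemma cos_abs_diff: "cos (pi * real (abs_diff k k') * t) = cos (pi * real k * t - pi * real k' * t)"
proof (cases "k' \<le> k")
  case True
  then have "pi * real (abs_diff k k') * t = pi * real k * t - pi * real k' * t"
    by (simp add: abs_diff_def algebra_simps)
  then show ?thesis
    by (simp only:)
next
  case False
  then have "pi * real (abs_diff k k') * t = - (pi * real k * t - pi * real k' * t)"
    by (simp add: abs_diff_def algebra_simps)
  then show ?thesis
    by (simp only: cos_minus)
qed

text \<open>Expanding both cosines, the sine products cancel and the cosine products add up.\<close>

lemma cos_toeplitz_plus_hankel:
  "cos (pi * real (abs_diff k k') * t) + cos (pi * real (k + k') * t) =
     2 * (cos (pi * real k * t) * cos (pi * real k' * t))"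
proof -
  have "pi * real (k + k') * t = pi * real k * t + pi * real k' * t"
    by (simp add: algebra_simps)
  then show ?thesis
    by (simp add: cos_abs_diff cos_diff cos_add)
qed

text \<open>For each point the four terms factor into a Toeplitz-plus-Hankel sum in \<open>x\<close>
  times one in \<open>y\<close>. Each factor contributes a 2, hence the 4.\<close>

lemma cos_moment_toeplitz_plus_hankel:
  "cos_moment r w x y (abs_diff l l') (abs_diff k k') + cos_moment r w x y (abs_diff l l') (k + k') +
     (cos_moment r w x y (l + l') (abs_diff k k') + cos_moment r w x y (l + l') (k + k')) =
   4 * (\<Sum>i<r. w (Suc i) *
     (cos (pi * real k * x (Suc i)) * cos (pi * real k' * x (Suc i))) *
     (cos (pi * real l * y (Suc i)) * cos (pi * real l' * y (Suc i))))"
    (is "?lhs = 4 * (\<Sum>i<r. w (Suc i) * ?X i * ?Y i)")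
proof -
  have "?lhs = (\<Sum>i<r. w (Suc i) *
      (cos (pi * real (abs_diff k k') * x (Suc i)) + cos (pi * real (k + k') * x (Suc i))) *
      (cos (pi * real (abs_diff l l') * y (Suc i)) + cos (pi * real (l + l') * y (Suc i))))"
    unfolding cos_moment_def sum.distrib[symmetric]
    by (rule sum.cong) (simp_all only: ring_distribs ac_simps)
  also have "\<dots> = (\<Sum>i<r. 4 * (w (Suc i) * ?X i * ?Y i))"
    unfolding cos_toeplitz_plus_hankel by (rule sum.cong) simp_all
  finally show ?thesis
    by (simp only: sum_distrib_left)
qed

lemma block_index_less:
  assumes "i < p * (m :: nat)"
  shows "i div m < p" "i mod m < m"
proof -
  from assms have "m > 0"
    by (cases m) simp_all
  with assms show "i div m < p" "i mod m < m"
    by (simp_all add: less_mult_imp_div_less)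
qed

lemma block_mat_carrier [simp]: "block_mat p q m n B \<in> carrier_mat (p * m) (q * n)"
  by (simp add: block_mat_def)

lemma index_block_mat [simp]:
  "i < p * m \<Longrightarrow> j < q * n \<Longrightarrow>
     block_mat p q m n B $$ (i, j) = B (i div m) (j div n) $$ (i mod m, j mod n)"
  by (simp add: block_mat_def)

text \<open>Quotient and remainder vanish together only for \<open>i = 0\<close>. Thus \<epsilon>
  depends on the global column index alone and matches the diagonal of \<open>D_mat\<close>.\<close>

lemma eps_mod_div: "eps (i mod n) (i div n) = (if i = 0 then 1 / sqrt 2 else 1)"
proof -
  have "i mod n = 0 \<and> i div n = 0 \<longleftrightarrow> i = 0"
    using div_mult_mod_eq[of i n] by (metis add_0 div_0 mod_0 mult_0)
  then show ?thesis
    by (simp add: eps_def)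
qed

lemma V_mat_carrier: "V_mat Mx My r w x y \<in> carrier_mat r ((My + 1) * (Mx + 1))"
  unfolding V_mat_def using block_mat_carrier[of 1 "My + 1" r "Mx + 1"] by simp

lemma index_V_mat:
  assumes "i < r" "c < (My + 1) * (Mx + 1)"
  shows "V_mat Mx My r w x y $$ (i, c) =
    (if c = 0 then 1 / sqrt 2 else 1) * sqrt (w (Suc i)) *
    cos (pi * real (c mod (Mx + 1)) * x (Suc i)) * cos (pi * real (c div (Mx + 1)) * y (Suc i))"
proof -
  \<comment> \<open>There is a single block row of height \<open>r\<close>, so
    \<open>i mod r = i\<close>.\<close>
  have "V_mat Mx My r w x y $$ (i, c) = V_block Mx r w x y (c div (Mx + 1)) $$ (i, c mod (Mx + 1))"
    using assms unfolding V_mat_def by (subst index_block_mat) simp_all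
  also have "\<dots> = eps (c mod (Mx + 1)) (c div (Mx + 1)) * sqrt (w (Suc i)) *
    cos (pi * real (c mod (Mx + 1)) * x (Suc i)) * cos (pi * real (c div (Mx + 1)) * y (Suc i))"
    using assms(1) block_index_less(2)[OF assms(2)] by (simp add: V_block_def Let_def)
  finally show ?thesis
    by (simp only: eps_mod_div)
qed

text \<open>The diagonal factors do not depend on the summation index and leave the sum; for
  nonnegative weights the two square roots multiply to \<open>w\<close>.\<close>

lemma index_gram_V_mat:
  fixes Mx My :: nat
  defines "n \<equiv> Mx + 1"
  assumes c: "c < (My + 1) * n" "c' < (My + 1) * n"
    and w: "\<And>j. j \<in> {1..r} \<Longrightarrow> w j \<ge> 0"
  shows "(transpose_mat (V_mat Mx My r w x y) * V_mat Mx My r w x y) $$ (c, c') =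
    (if c = 0 then 1 / sqrt 2 else 1) * (if c' = 0 then 1 / sqrt 2 else 1) *
    (\<Sum>i<r. w (Suc i) *
      (cos (pi * real (c mod n) * x (Suc i)) * cos (pi * real (c' mod n) * x (Suc i))) *
      (cos (pi * real (c div n) * y (Suc i)) * cos (pi * real (c' div n) * y (Suc i))))"
proof -
  let ?V = "V_mat Mx My r w x y"
  have carrier: "?V \<in> carrier_mat r ((My + 1) * n)"
    unfolding n_def by (rule V_mat_carrier)
  then have "(transpose_mat ?V * ?V) $$ (c, c') = (\<Sum>i<r. ?V $$ (i, c) * ?V $$ (i, c'))"
    using c by (simp add: scalar_prod_def atLeast0LessThan)
  also have "\<dots> = (\<Sum>i<r. (if c = 0 then 1 / sqrt 2 else 1) * (if c' = 0 then 1 / sqrt 2 else 1) *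
     (w (Suc i) *
      (cos (pi * real (c mod n) * x (Suc i)) * cos (pi * real (c' mod n) * x (Suc i))) *
      (cos (pi * real (c div n) * y (Suc i)) * cos (pi * real (c' div n) * y (Suc i)))))"
  proof (rule sum.cong)
    fix i assume "i \<in> {..<r}"
    then have i: "i < r" by simp
    \<comment> \<open>Stating the rearrangement for arbitrary reals keeps it a pure reordering of
      factors, with the cosines and conditionals left opaque.\<close>
    have regroup: "(d * s * p * q) * (d' * s * p' * q') = d * d' * (v * (p * p') * (q * q'))"
      if "s * s = v" for d d' s v p p' q q' :: real
      unfolding that[symmetric] by (simp only: ac_simps)
    from i have sqrt_w: "sqrt (w (Suc i)) * sqrt (w (Suc i)) = w (Suc i)"
      using w[of "Suc i"] by simp
    show "?V $$ (i, c) * ?V $$ (i, c') =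
      (if c = 0 then 1 / sqrt 2 else 1) * (if c' = 0 then 1 / sqrt 2 else 1) * (w (Suc i) *
       (cos (pi * real (c mod n) * x (Suc i)) * cos (pi * real (c' mod n) * x (Suc i))) *
       (cos (pi * real (c div n) * y (Suc i)) * cos (pi * real (c' div n) * y (Suc i))))"
      unfolding index_V_mat[OF i c(1)[unfolded n_def]] index_V_mat[OF i c(2)[unfolded n_def]] n_def
      by (rule regroup[OF sqrt_w])
  qed simp
  finally show ?thesis
    by (simp only: sum_distrib_left)
qed

text \<open>The four terms arise from choosing Toeplitz or Hankel first between blocks and then
  within the chosen block.\<close>

lemma index_block_toeplitz_plus_hankel:
  assumes "i < p * n" "j < p * n"
    and "\<And>q. B q = toeplitz_mat n (a q) + hankel_mat n (a q)"
  shows "(block_toeplitz_mat p n B + block_hankel_mat p n B) $$ (i, j) =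
    a (abs_diff (i div n) (j div n)) (abs_diff (i mod n) (j mod n)) +
    a (abs_diff (i div n) (j div n)) (i mod n + j mod n) +
    (a (i div n + j div n) (abs_diff (i mod n) (j mod n)) +
     a (i div n + j div n) (i mod n + j mod n))"
proof -
  \<comment> \<open>The entry rule for a matrix sum takes its index bounds from the second
    summand.\<close>
  have "dim_row (block_hankel_mat p n B) = p * n" "dim_col (block_hankel_mat p n B) = p * n"
    by (simp_all add: block_hankel_mat_def block_mat_def)
  then show ?thesis
    using assms block_index_less[OF assms(1)] block_index_less[OF assms(2)]
    by (simp add: block_toeplitz_mat_def block_hankel_mat_def toeplitz_mat_def hankel_mat_def)
qed

lemma D_mat_mult_mult:
  assumes "A \<in> carrier_mat n n"
  shows "D_mat n * A * D_mat n =
    mat n n (\<lambda>(i, j). (if i = 0 then 1 / sqrt 2 else 1) * A $$ (i, j) * (if j = 0 then 1 / sqrt 2 else 1))"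
  unfolding D_mat_def mat_diag_mult_left[OF assms]
  by (subst mat_diag_mult_right[of _ n]) (auto intro!: eq_matI)

theorem theorem4p1:
  fixes Mx My r :: nat and x y w :: "nat \<Rightarrow> real"
  assumes "r \<ge> 1"
    and "\<And>j. j \<in> {1..r} \<Longrightarrow> x j \<in> {0..1} \<and> y j \<in> {0..1}"
    and "inj_on (\<lambda>j. (x j, y j)) {1..r}"
    and "\<And>j. j \<in> {1..r} \<Longrightarrow> w j > 0"
  defines "V \<equiv> V_mat Mx My r w x y"
    and "D \<equiv> D_mat ((Mx + 1) * (My + 1))"
  shows "\<exists>B :: nat \<Rightarrow> real mat.
     (\<forall>q \<le> 2 * My. \<exists>a :: nat \<Rightarrow> real.
        B q = toeplitz_mat (Mx + 1) a + hankel_mat (Mx + 1) a) \<and>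
     transpose_mat V * V =
       D * (block_toeplitz_mat (My + 1) (Mx + 1) B + block_hankel_mat (My + 1) (Mx + 1) B) * D"
proof -
  define n where "n = Mx + 1"
  define N where "N = (My + 1) * n"
  define a where "a q p = cos_moment r w x y q p / 4" for q p
  define B where "B q = toeplitz_mat n (a q) + hankel_mat n (a q)" for q
  let ?S = "block_toeplitz_mat (My + 1) n B + block_hankel_mat (My + 1) n B"
  have S: "?S \<in> carrier_mat N N"
    unfolding block_toeplitz_mat_def block_hankel_mat_def N_def by (intro add_carrier_mat block_mat_carrier)
  \<comment> \<open>The two factors of the size are swapped to agree with the dimension of the block
    matrices.\<close>
  have D: "D = D_mat N"
    unfolding D_def N_def n_def by (simp only: mult.commute)
  have V: "V \<in> carrier_mat r N"
    unfolding V_def N_def n_def by (rule V_mat_carrier)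
  have "transpose_mat V * V = D * ?S * D"
    unfolding D D_mat_mult_mult[OF S]
  proof (rule eq_matI)
    fix c c' assume "c < dim_row (mat N N (\<lambda>(i, j). (if i = 0 then 1 / sqrt 2 else 1) * ?S $$ (i, j) *
        (if j = 0 then 1 / sqrt 2 else 1)))"
      and "c' < dim_col (mat N N (\<lambda>(i, j). (if i = 0 then 1 / sqrt 2 else 1) * ?S $$ (i, j) *
        (if j = 0 then 1 / sqrt 2 else 1)))"
    then have c: "c < N" "c' < N" by simp_all
    \<comment> \<open>The quarter in \<open>a\<close> cancels the factor 4 of the moment identity,
      leaving exactly the sum that occurs in the Gram entry.\<close>
    have "?S $$ (c, c') = (\<Sum>i<r. w (Suc i) *
      (cos (pi * real (c mod n) * x (Suc i)) * cos (pi * real (c' mod n) * x (Suc i))) *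
      (cos (pi * real (c div n) * y (Suc i)) * cos (pi * real (c' div n) * y (Suc i))))"
      using index_block_toeplitz_plus_hankel[OF c[unfolded N_def] B_def]
        cos_moment_toeplitz_plus_hankel[of r w x y "c div n" "c' div n" "c mod n" "c' mod n"]
      by (simp add: a_def)
    moreover have "w j \<ge> 0" if "j \<in> {1..r}" for j
      using assms(4)[OF that] by simp
    ultimately have "(transpose_mat V * V) $$ (c, c') =
      (if c = 0 then 1 / sqrt 2 else 1) * (if c' = 0 then 1 / sqrt 2 else 1) * ?S $$ (c, c')"
      using index_gram_V_mat[OF c[unfolded N_def n_def], of r w x y]
      unfolding V_def n_def by simp
    then show "(transpose_mat V * V) $$ (c, c') =
      mat N N (\<lambda>(i, j). (if i = 0 then 1 / sqrt 2 else 1) * ?S $$ (i, j) *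
        (if j = 0 then 1 / sqrt 2 else 1)) $$ (c, c')"
      using c by simp
  qed (use V in simp_all)
  then show ?thesis
    unfolding n_def by (intro exI[of _ B]) (auto simp: B_def n_def)
qed

end
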